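(* Let $n$ be a positive integer and $w\in W^{\mathsf{BC}}_n$. Then \[ \mathfrak{S}^{\mathsf{C}}_w(x_i \mapsto q^{i-1}) = \sum_{a=a_1a_2\cdots a_p \in \mathsf{Reduced}_C(w)} \frac{(q^{a_1}+1)(q^{a_2}+1)\cdots (q^{a_p}+1)}{(q-1)(q^{2}-1)\cdots (q^{p}-1)}\, q^{\operatorname{comaj}(a)}, \] where each summand on the right is expanded as a Laurent series in $q^{-1}$.
   Context: Let $x_i$ ($i\in\mathbb{Z}$) be commuting indeterminates. For $0<i<n$ let $t_i=t_{-i}=(i,i+1)(-i,-i-1)$ (permutations of $\mathbb{Z}$) and $t_0=(-1,1)$. $W^{\mathsf{BC}}_n=\langle t_0,\dots,t_{n-1}\rangle$ is the Coxeter group of permutations $w$ of $\mathbb{Z}$ with $w(i)=i$ for $|i|>n$ and $w(-i)=-w(i)$. Let $-0$ be a formal symbol with $-1<-0<0<1$ and $t_{-0}=t_0$. A signed reduced word of type C for $w$ is a word $a_1\cdots a_p$ with letters in $\{-n+1<\dots<-1<-0<0<1<\dots<n-1\}$ of minimal length with $w=t_{a_1}\cdots t_{a_p}$; $\mathsf{Reduced}^\pm_C(w)$ is the set of these, and $\mathsf{Reduced}_C(w)$ is the subset of those words whose letters all lie in $\{0,1,\dots,n-1\}$ (with $0$ the symbol $0$, not $-0$). For a word $a=a_1\cdots a_p$ in this ordered alphabet, a bounded compatible sequence is a weakly increasing integer sequence $\mathbf{i}=(i_1\le\dots\le i_p)$ with $i_j<i_{j+1}$ whenever $a_j\le a_{j+1}$,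 and $i_j\le a_j$ whenever $0<i_j$ (comparisons in the ordered alphabet containing $\mathbb{Z}$); $\mathsf{Compatible}(a)$ is the set of these and $x_{\mathbf{i}}=x_{i_1}\cdots x_{i_p}$. Define $\mathfrak{S}^{\mathsf{C}}_w=\sum_{a\in\mathsf{Reduced}^\pm_C(w)}\sum_{\mathbf{i}\in\mathsf{Compatible}(a)}x_{\mathbf{i}}\in\mathbb{Z}[[\dots,x_{-1},x_0,x_1,\dots,x_{n-1}]]$. $F(x_i\mapsto q^{i-1})$ denotes the Laurent series in $q^{-1}$ obtained by setting $x_i=q^{i-1}$ for all integers $i<n$. $\operatorname{comaj}(a)=\sum_{i:\,a_i<a_{i+1}} i$. *)

theory Defs
  imports
    "HOL-Computational_Algebra.Formal_Laurent_Series"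
    "HOL-Combinatorics.Permutations"
    "HOL-Library.Poly_Mapping"
begin

section \<open>Signed permutations\<close>

definition W_BC :: "nat \<Rightarrow> (int \<Rightarrow> int) set" where
  "W_BC n = {w. w permutes {- int n..int n} \<and> (\<forall>i. w (- i) = - w i)}"

definition t_BC :: "int \<Rightarrow> int \<Rightarrow> int" where
  "t_BC i =
     (if i = 0 then transpose (- 1) 1
      else transpose \<bar>i\<bar> (\<bar>i\<bar> + 1) \<circ> transpose (- \<bar>i\<bar>) (- \<bar>i\<bar> - 1))"

section \<open>The ordered alphabet\<close>

text \<open>The set of integers together with one extra symbol \<open>NegZero\<close>, standing for \<open>-0\<close>, placed
  between \<open>-1\<close> and \<open>0\<close>. The rank below embeds it in the integers preserving this order.\<close>

datatype letter = Letter int | NegZero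

fun letter_rank :: "letter \<Rightarrow> int" where
  "letter_rank (Letter i) = 2 * i"
| "letter_rank NegZero = - 1"

instantiation letter :: linorder
begin

definition less_eq_letter :: "letter \<Rightarrow> letter \<Rightarrow> bool" where
  "x \<le> y \<longleftrightarrow> letter_rank x \<le> letter_rank y"

definition less_letter :: "letter \<Rightarrow> letter \<Rightarrow> bool" where
  "x < y \<longleftrightarrow> letter_rank x < letter_rank y"

instance
proof
  fix x y :: letter
  assume "x \<le> y" "y \<le> x"
  then have "letter_rank x = letter_rank y"
    by (simp add: less_eq_letter_def)
  then show "x = y"
    by (cases x; cases y) (auto, presburger+)
qed (auto simp: less_eq_letter_def less_letter_def)

end

fun letter_val :: "letter \<Rightarrow> int" where
  "letter_val (Letter i) = i"
| "letter_val NegZero = 0"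

text \<open>\<open>NegZero\<close> is inserted explicitly, so that it also belongs to the alphabet for \<open>n = 1\<close>.\<close>

definition alphabet :: "nat \<Rightarrow> letter set" where
  "alphabet n = insert NegZero (Letter ` {- int n + 1..int n - 1})"

section \<open>Reduced words and compatible sequences\<close>

definition word_perm :: "letter list \<Rightarrow> int \<Rightarrow> int" where
  "word_perm a = foldr (\<circ>) (map (\<lambda>l. t_BC (letter_val l)) a) id"

definition Reduced_pm_C :: "nat \<Rightarrow> (int \<Rightarrow> int) \<Rightarrow> letter list set" where
  "Reduced_pm_C n w =
     {a. set a \<subseteq> alphabet n \<and> word_perm a = w \<and>
         (\<forall>b. set b \<subseteq> alphabet n \<and> word_perm b = w \<longrightarrow> length a \<le> length b)}"

definition Reduced_C :: "nat \<Rightarrow> (int \<Rightarrow> int) \<Rightarrow> letter list set" where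
  "Reduced_C n w = {a \<in> Reduced_pm_C n w. set a \<subseteq> Letter ` {0..int n - 1}}"

definition Compatible :: "letter list \<Rightarrow> int list set" where
  "Compatible a =
     {i. length i = length a \<and> sorted i \<and>
         (\<forall>j. Suc j < length a \<longrightarrow> a ! j \<le> a ! Suc j \<longrightarrow> i ! j < i ! Suc j) \<and>
         (\<forall>j < length a. 0 < i ! j \<longrightarrow> Letter (i ! j) \<le> a ! j)}"

text \<open>Positions in words are counted from 1 here.\<close>

definition comaj :: "letter list \<Rightarrow> nat" where
  "comaj a = (\<Sum>j | 1 \<le> j \<and> j < length a \<and> a ! (j - 1) < a ! j. j)"

section \<open>The power series\<close>

text \<open>A monomial in the indeterminates \<open>x\<^sub>i\<close> (\<open>i\<close> an integer) is its finitely supported exponent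
  vector, and a formal power series in infinitely many indeterminates is the family of its
  coefficients.\<close>

type_synonym monomial = "int \<Rightarrow>\<^sub>0 nat"
type_synonym series = "monomial \<Rightarrow> int"

definition x_mon :: "int list \<Rightarrow> monomial" where
  "x_mon i = sum_list (map (\<lambda>k. Poly_Mapping.single k 1) i)"

text \<open>The sets of sequences counted here are finite, because a compatible sequence is weakly
  increasing and hence determined by its monomial.\<close>

definition S_C :: "nat \<Rightarrow> (int \<Rightarrow> int) \<Rightarrow> series" where
  "S_C n w = (\<lambda>m. \<Sum>a \<in> Reduced_pm_C n w. int (card {i \<in> Compatible a. x_mon i = m}))"

section \<open>Substituting Laurent series\<close>

text \<open>Infinite sums of formal Laurent series are formed coefficientwise. The family is summable if
  every coefficient receives finitely many nonzero contributions and the orders are uniformly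
  bounded below; otherwise \<open>fls_sum\<close> is not meaningful.\<close>

definition fls_summable :: "('b \<Rightarrow> 'a::comm_monoid_add fls) \<Rightarrow> bool" where
  "fls_summable f \<longleftrightarrow>
     (\<forall>k. finite {m. fls_nth (f m) k \<noteq> 0}) \<and> (\<exists>N. \<forall>m. \<forall>k < N. fls_nth (f m) k = 0)"

definition fls_sum :: "('b \<Rightarrow> 'a::comm_monoid_add fls) \<Rightarrow> 'a fls" where
  "fls_sum f = Abs_fls (\<lambda>k. \<Sum>m | fls_nth (f m) k \<noteq> 0. fls_nth (f m) k)"

definition eval_term :: "(int \<Rightarrow> rat fls) \<Rightarrow> series \<Rightarrow> monomial \<Rightarrow> rat fls" where
  "eval_term v F m =
     of_int (F m) * (\<Prod>i \<in> Poly_Mapping.keys m. v i ^ Poly_Mapping.lookup m i)"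

definition substitutable :: "(int \<Rightarrow> rat fls) \<Rightarrow> series \<Rightarrow> bool" where
  "substitutable v F \<longleftrightarrow> fls_summable (eval_term v F)"

definition subst_series :: "(int \<Rightarrow> rat fls) \<Rightarrow> series \<Rightarrow> rat fls" where
  "subst_series v F = fls_sum (eval_term v F)"

text \<open>The variable of the Laurent series is \<open>q\<^sup>-\<^sup>1\<close>, so \<open>q\<close> is the inverse of \<open>fls_X\<close>, and arithmetic
  (including division) in \<open>rat fls\<close> is expansion as Laurent series in \<open>q\<^sup>-\<^sup>1\<close>. Rational
  coefficients are used only to have a field.\<close>

abbreviation q_fls :: "rat fls" where
  "q_fls \<equiv> fls_X_inv"

end

theory Submission
  imports Defs
begin

text \<open>The proof follows Fomin and Stanley. Let \<open>u\<^sub>0, \<dots>, u\<^bsub>n-1\<^esub>\<close> be the generators of the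
  nil-Coxeter algebra and \<open>h\<^sub>i(x) = 1 + x u\<^sub>i\<close>. Put \<open>A\<^sub>i(x) = h\<^bsub>n-1\<^esub>(x) \<dots> h\<^sub>i(x)\<close>,
  \<open>B(x) = h\<^bsub>n-1\<^esub>(x) \<dots> h\<^sub>1(x) h\<^sub>0(x)\<^sup>2 h\<^sub>1(x) \<dots> h\<^bsub>n-1\<^esub>(x)\<close> and
  \<open>C(x) = h\<^sub>0(2 x) h\<^sub>1((q + 1) x) \<dots> h\<^bsub>n-1\<^esub>((q\<^bsup>n-1\<^esup> + 1) x)\<close>. Reading compatible sequences by
  increasing entries, the left-hand sides are the coefficients of \<open>S(1)\<close>, where
  \<open>S(z) = (\<dots> B(z q\<^sup>-\<^sup>2) B(z q\<^sup>-\<^sup>1)) A\<^sub>1(z) A\<^sub>2(q z) \<dots> A\<^bsub>n-1\<^esub>(q\<^bsup>n-2\<^esup> z)\<close>. The Yang-Baxter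
  equation of type A implies that \<open>h\<^sub>i(x) \<dots> h\<^bsub>n-1\<^esub>(x)\<close> commutes with \<open>A\<^sub>i(y)\<close> for
  \<open>i > 0\<close>, and from this one gets
  \<open>B(z) A\<^sub>1(q z) \<dots> A\<^bsub>n-1\<^esub>(q\<^bsup>n-1\<^esup> z) = A\<^sub>1(z) \<dots> A\<^bsub>n-1\<^esub>(q\<^bsup>n-2\<^esup> z) C(z)\<close>, that is,
  \<open>S(q z) = S(z) C(z)\<close>. Termwise in the words, the right-hand sides satisfy the same equation. As
  \<open>q\<^sup>p \<noteq> 1\<close> for \<open>p > 0\<close>, its solution with constant term 1 is unique. The variable \<open>z\<close> is
  redundant, because the coefficient of \<open>u\<^sub>w\<close> is homogeneous of degree the length of \<open>w\<close>.\<close>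

section \<open>Products in the nil-Coxeter algebra\<close>

text \<open>The operators act from the right: the first entry of the list is applied first.\<close>

definition act :: "(nat \<Rightarrow> 'k \<Rightarrow> 'v \<Rightarrow> 'v) \<Rightarrow> (nat \<times> 'k) list \<Rightarrow> 'v \<Rightarrow> 'v" where
  "act h xs = fold (\<lambda>(i, x). h i x) xs"

lemma act_Nil [simp]: "act h [] f = f"
  and act_Cons [simp]: "act h ((i, x) # xs) f = act h xs (h i x f)"
  and act_append [simp]: "act h (xs @ ys) f = act h ys (act h xs f)"
  by (simp_all add: act_def)

definition ascending :: "nat \<Rightarrow> 'k \<Rightarrow> nat \<Rightarrow> (nat \<times> 'k) list" where
  "ascending n x i = map (\<lambda>k. (k, x)) [i..<n]"

definition descending :: "nat \<Rightarrow> 'k \<Rightarrow> nat \<Rightarrow> (nat \<times> 'k) list" where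
  "descending n x i = rev (ascending n x i)"

lemma ascending_Cons: "i < n \<Longrightarrow> ascending n x i = (i, x) # ascending n x (Suc i)"
  by (simp add: ascending_def upt_conv_Cons)

lemma descending_snoc: "i < n \<Longrightarrow> descending n x i = descending n x (Suc i) @ [(i, x)]"
  by (simp add: descending_def ascending_Cons)

lemma ascending_Nil [simp]: "n \<le> i \<Longrightarrow> ascending n x i = []"
  by (simp add: ascending_def)

lemma descending_Nil [simp]: "n \<le> i \<Longrightarrow> descending n x i = []"
  by (simp add: descending_def)

text \<open>\<open>braid\<close> is the additive form of the Yang-Baxter equation. It is stated for
  \<open>0 < i\<close> because the generators 0 and 1 satisfy a relation of length four; factors of
  index 0 are handled by \<open>additive\<close> and \<open>commuting\<close>.\<close>

locale yang_baxter =
  fixes n :: nat and h :: "nat \<Rightarrow> 'k::comm_ring_1 \<Rightarrow> 'v \<Rightarrow> 'v"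
  assumes additive: "i < n \<Longrightarrow> h i x (h i y f) = h i (x + y) f"
    and commuting: "i < n \<Longrightarrow> j < n \<Longrightarrow> Suc i < j \<Longrightarrow> h i x (h j y f) = h j y (h i x f)"
    and braid: "0 < i \<Longrightarrow> Suc i < n \<Longrightarrow>
      h i x (h (Suc i) (x + y) (h i y f)) = h (Suc i) y (h i (x + y) (h (Suc i) x f))"
begin

lemma act_commute:
  assumes "i < n" "\<And>p. p \<in> set xs \<Longrightarrow> Suc i < fst p \<and> fst p < n"
  shows "act h xs (h i x f) = h i x (act h xs f)"
  using assms(2)
proof (induction xs arbitrary: f)
  case (Cons p xs)
  obtain j y where p: "p = (j, y)" by force
  with Cons.prems[of p] have "Suc i < j" "j < n" by auto
  then show ?case
    using Cons assms(1) by (simp add: p flip: commuting)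
qed simp

lemma act_ascending_commute:
  "i < n \<Longrightarrow> Suc i < j \<Longrightarrow> act h (ascending n y j) (h i x f) = h i x (act h (ascending n y j) f)"
  by (rule act_commute) (auto simp: ascending_def)

lemma act_descending_commute:
  "i < n \<Longrightarrow> Suc i < j \<Longrightarrow> act h (descending n y j) (h i x f) = h i x (act h (descending n y j) f)"
  by (rule act_commute) (auto simp: ascending_def descending_def)

text \<open>Downward induction on \<open>i\<close>: the factors of index \<open>i\<close> stand at
  the two ends, the induction hypothesis swaps what lies between them, and the Yang-Baxter equation
  then applies to the indices \<open>i\<close> and \<open>Suc i\<close>.\<close>

lemma ascending_descending_commute:
  assumes "0 < i"
  shows "act h (ascending n x i @ descending n y i) f = act h (descending n y i @ ascending n x i) f"
  using assms
proof (induction "n - i" arbitrary: i f)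
  case (Suc d)
  then have i: "i < n" by simp
  have IH: "act h (ascending n x j @ descending n y j) g = act h (descending n y j @ ascending n x j) g"
    if "j = Suc i" for j g
    using Suc.hyps(1)[of j] Suc.hyps(2) that by simp
  show ?case
  proof (cases "Suc i < n")
    case False
    then show ?thesis
      using i by (simp add: ascending_Cons descending_snoc additive add.commute)
  next
    case True
    let ?D = "act h (descending n y (Suc (Suc i)))" and ?A = "act h (ascending n x (Suc (Suc i)))"
    have A: "act h (ascending n x i) g = ?A (h (Suc i) x (h i x g))"
      and D: "act h (descending n y i) g = h i y (h (Suc i) y (?D g))"
      and A': "act h (ascending n x (Suc i)) g = ?A (h (Suc i) x g)"
      and D': "act h (descending n y (Suc i)) g = h (Suc i) y (?D g)" for g
      using i True by (simp_all add: ascending_Cons[of i] ascending_Cons[of "Suc i"]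
          descending_snoc[of i] descending_snoc[of "Suc i"])
    have "act h (ascending n x i @ descending n y i) f =
        h i y (act h (ascending n x (Suc i) @ descending n y (Suc i)) (h i x f))"
      by (simp add: A D A' D')
    \<comment> \<open>After the swap the two factors of index \<open>Suc i\<close> are adjacent and
      merge into the parameter \<open>y + x\<close> that \<open>braid\<close> requires.\<close>
    also have "\<dots> = h i y (?A (h (Suc i) (y + x) (?D (h i x f))))"
      using True IH[OF refl, of "h i x f"] by (simp add: A' D' additive add.commute[of y x])
    also have "\<dots> = ?A (h i y (h (Suc i) (y + x) (h i x (?D f))))"
      using i by (simp add: act_ascending_commute act_descending_commute)
    also have "\<dots> = ?A (h (Suc i) x (h i (y + x) (h (Suc i) y (?D f))))"
      using Suc.prems True by (simp add: braid)
    also have "\<dots> = act h (descending n y i @ ascending n x i) f"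
      using i by (simp add: A D additive add.commute)
    finally show ?thesis .
  qed
qed simp

text \<open>Once the runs are commuted, their factors of index \<open>i\<close> are adjacent in the
  middle and merge.\<close>

lemma ascending_descending_exchange:
  assumes "0 < i" "i < n"
  shows "act h (ascending n x i @ descending n y i) f =
    act h (descending n y (Suc i) @ (i, x + y) # ascending n x (Suc i)) f"
  unfolding ascending_descending_commute[OF assms(1)]
  using assms by (simp add: ascending_Cons descending_snoc additive)

text \<open>The ascending run is pushed through the descending runs one at a time. Each exchange
  strips the lowest factor from both runs and leaves one factor of C(1).\<close>

lemma ascending_staircase:
  assumes "0 < i" "i \<le> n"
  shows "act h (ascending n 1 i @ concat (map (\<lambda>k. descending n (q ^ k) k) [i..<n])) f =
    act h (concat (map (\<lambda>k. descending n (q ^ k) (Suc k)) [i..<n]) @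
      map (\<lambda>k. (k, q ^ k + 1)) [i..<n]) f"
  using assms
proof (induction "n - i" arbitrary: i f)
  case (Suc d)
  then have i: "i < n" by simp
  let ?L = "\<lambda>i. concat (map (\<lambda>k. descending n (q ^ k) k) [i..<n])"
    and ?R = "\<lambda>i. concat (map (\<lambda>k. descending n (q ^ k) (Suc k)) [i..<n])"
    and ?C = "\<lambda>i. map (\<lambda>k. (k, q ^ k + 1)) [i..<n]"
  have IH: "act h (ascending n 1 (Suc i) @ ?L (Suc i)) g = act h (?R (Suc i) @ ?C (Suc i)) g" for g
    using Suc.hyps(1)[of "Suc i"] Suc.hyps(2) i by simp
  have "act h (ascending n 1 i @ ?L i) f =
      act h (?L (Suc i)) (act h (ascending n 1 i @ descending n (q ^ i) i) f)"
    using i by (simp add: upt_conv_Cons)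
  also have "\<dots> = act h (ascending n 1 (Suc i) @ ?L (Suc i))
      (h i (q ^ i + 1) (act h (descending n (q ^ i) (Suc i)) f))"
    using Suc.prems i by (subst ascending_descending_exchange) (simp_all add: add.commute)
  also have "\<dots> = act h (?C (Suc i)) (act h (?R (Suc i))
      (h i (q ^ i + 1) (act h (descending n (q ^ i) (Suc i)) f)))"
    by (subst IH) simp
  \<comment> \<open>The runs in \<open>?R (Suc i)\<close> contain only indices from
    \<open>i + 2\<close> on, so the factor of index \<open>i\<close> passes them.\<close>
  also have "\<dots> = act h (?C (Suc i)) (h i (q ^ i + 1) (act h (?R (Suc i))
      (act h (descending n (q ^ i) (Suc i)) f)))"
    using i by (subst act_commute) (auto simp: ascending_def descending_def)
  also have "\<dots> = act h (?R i @ ?C i) f"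
    using i by (simp add: upt_conv_Cons)
  finally show ?case .
qed simp

text \<open>The case z = 1 of the commutation of B with the staircase. The two factors of index 0 in
  B(1) merge to the parameter 2 = \<open>q ^ 0 + 1\<close>, which is the first factor of
  C(1).\<close>

lemma staircase_functional_equation:
  assumes "0 < n"
  shows "act h ((descending n 1 0 @ ascending n 1 0) @
      concat (map (\<lambda>k. descending n (q ^ k) k) [1..<n])) f =
    act h (concat (map (\<lambda>k. descending n (q ^ (k - 1)) k) [1..<n]) @
      map (\<lambda>k. (k, q ^ k + 1)) [0..<n]) f"
proof -
  let ?R = "concat (map (\<lambda>k. descending n (q ^ k) (Suc k)) [1..<n])"
  let ?D = "act h (descending n 1 1) f"
  \<comment> \<open>Shifting \<open>k\<close> by one identifies the descending run of B(1) and the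
    runs left over by the exchanges with A_1(1) A_2(q) and so on. The run starting at index
    \<open>n\<close> is empty.\<close>
  have "map (\<lambda>k. descending n (q ^ k) (Suc k)) [0..<n] =
      map (\<lambda>k. descending n (q ^ (k - 1)) k) [1..<Suc n]"
    by (simp add: map_Suc_upt[of 0 n, symmetric] o_def del: upt_Suc map_Suc_upt)
  then have "concat (map (\<lambda>k. descending n (q ^ k) (Suc k)) [0..<n]) =
      concat (map (\<lambda>k. descending n (q ^ (k - 1)) k) [1..<n])"
    using assms by simp
  then have shift: "descending n 1 1 @ ?R =
      concat (map (\<lambda>k. descending n (q ^ (k - 1)) k) [1..<n])"
    using assms by (simp add: upt_conv_Cons)
  have "act h ((descending n 1 0 @ ascending n 1 0) @
        concat (map (\<lambda>k. descending n (q ^ k) k) [1..<n])) f =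
      act h (ascending n 1 1 @ concat (map (\<lambda>k. descending n (q ^ k) k) [1..<n])) (h 0 2 ?D)"
    using assms by (simp add: ascending_Cons[of 0] descending_snoc[of 0] additive)
  also have "\<dots> = act h (map (\<lambda>k. (k, q ^ k + 1)) [1..<n]) (act h ?R (h 0 2 ?D))"
    using assms by (subst ascending_staircase) simp_all
  also have "act h ?R (h 0 2 ?D) = h 0 2 (act h ?R ?D)"
    using assms by (subst act_commute) (auto simp: ascending_def descending_def)
  also have "act h ?R ?D = act h (concat (map (\<lambda>k. descending n (q ^ (k - 1)) k) [1..<n])) f"
    by (simp only: act_append flip: shift)
  finally show ?thesis
    using assms by (simp add: upt_conv_Cons)
qed

end

section \<open>Nil-Coxeter operators of type BC\<close>

lemma t_BC_0: "t_BC 0 x = (if x = 1 then - 1 else if x = - 1 then 1 else x)"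
  by (simp add: t_BC_def transpose_def)

lemma t_BC_pos:
  "0 < i \<Longrightarrow> t_BC i x =
    (if x = i then i + 1 else if x = i + 1 then i
     else if x = - i then - i - 1 else if x = - i - 1 then - i else x)"
  by (auto simp: t_BC_def transpose_def)

lemma t_BC_involution: "t_BC i \<circ> t_BC i = id"
proof -
  have "t_BC i = t_BC \<bar>i\<bar>"
    by (simp add: t_BC_def)
  moreover have "t_BC \<bar>i\<bar> \<circ> t_BC \<bar>i\<bar> = id"
  proof (cases "i = 0")
    case False
    then have "0 < \<bar>i\<bar>" by simp
    then show ?thesis
      by (auto simp: fun_eq_iff t_BC_pos)
  qed (auto simp: fun_eq_iff t_BC_0)
  ultimately show ?thesis by simp
qed

lemma t_BC_commute:
  assumes "0 \<le> i" "i + 1 < j"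
  shows "t_BC i \<circ> t_BC j = t_BC j \<circ> t_BC i"
proof (cases "i = 0")
  case False
  with assms have "0 < i" "0 < j" by auto
  then show ?thesis
    using assms by (auto simp: fun_eq_iff t_BC_pos)
qed (use assms in \<open>auto simp: fun_eq_iff t_BC_pos t_BC_0\<close>)

lemma t_BC_braid:
  assumes "0 < i"
  shows "t_BC i \<circ> t_BC (i + 1) \<circ> t_BC i = t_BC (i + 1) \<circ> t_BC i \<circ> t_BC (i + 1)"
  using assms by (auto simp: fun_eq_iff t_BC_pos)

section \<open>Length of a signed permutation\<close>

lemma word_perm_Nil [simp]: "word_perm [] = id"
  by (simp add: word_perm_def)

lemma word_perm_snoc: "word_perm (a @ [l]) = word_perm a \<circ> t_BC (letter_val l)"
proof -
  have "foldr (\<circ>) ts s = foldr (\<circ>) ts id \<circ> s" for ts :: "('a \<Rightarrow> 'a) list" and s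
    by (induction ts) (simp_all add: comp_assoc)
  from this[of _ "t_BC (letter_val l)"] show ?thesis
    by (simp add: word_perm_def)
qed

text \<open>The infimum of the empty set is 0, so a permutation outside the group gets length 0.\<close>

definition len_BC :: "nat \<Rightarrow> (int \<Rightarrow> int) \<Rightarrow> nat" where
  "len_BC n w = Inf (length ` {a. set a \<subseteq> alphabet n \<and> word_perm a = w})"

lemma len_BC_le: "set a \<subseteq> alphabet n \<Longrightarrow> len_BC n (word_perm a) \<le> length a"
  unfolding len_BC_def by (rule cInf_lower) auto

lemma len_BC_attained:
  assumes "set a \<subseteq> alphabet n" "word_perm a = w"
  obtains b where "set b \<subseteq> alphabet n" "word_perm b = w" "length b = len_BC n w"
proof -
  have "len_BC n w \<in> length ` {a. set a \<subseteq> alphabet n \<and> word_perm a = w}"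
    unfolding len_BC_def by (rule Inf_nat_def1) (use assms in auto)
  with that show thesis by auto
qed

lemma Letter_in_alphabet: "i < n \<Longrightarrow> Letter (int i) \<in> alphabet n"
  by (auto simp: alphabet_def)

lemma comp_t_BC_cancel: "w \<circ> t_BC i \<circ> t_BC i = w"
  by (simp add: comp_assoc t_BC_involution)

lemma len_BC_comp_le:
  assumes "i < n"
  shows "len_BC n w \<le> Suc (len_BC n (w \<circ> t_BC (int i)))"
proof (cases "\<exists>a. set a \<subseteq> alphabet n \<and> word_perm a = w \<circ> t_BC (int i)")
  case True
  then obtain a where a: "set a \<subseteq> alphabet n" "word_perm a = w \<circ> t_BC (int i)"
      "length a = len_BC n (w \<circ> t_BC (int i))"
    using len_BC_attained by metis
  then have "word_perm (a @ [Letter (int i)]) = w"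
    by (simp only: word_perm_snoc letter_val.simps a comp_t_BC_cancel)
  with len_BC_le[of "a @ [Letter (int i)]" n] a assms show ?thesis
    by (simp add: Letter_in_alphabet)
next
  \<comment> \<open>If \<open>w \<circ> t_BC (int i)\<close> is not a product of generators then
    neither is \<open>w\<close>, and both lengths take the default value 0.\<close>
  case False
  have "\<nexists>a. set a \<subseteq> alphabet n \<and> word_perm a = w"
  proof
    assume "\<exists>a. set a \<subseteq> alphabet n \<and> word_perm a = w"
    then obtain a where "set a \<subseteq> alphabet n" "word_perm a = w" by auto
    then have "set (a @ [Letter (int i)]) \<subseteq> alphabet n"
        "word_perm (a @ [Letter (int i)]) = w \<circ> t_BC (int i)"
      using assms by (simp_all add: Letter_in_alphabet word_perm_snoc)
    with False show False by blast
  qed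
  with False have "{a. set a \<subseteq> alphabet n \<and> word_perm a = w} = {}"
      "{a. set a \<subseteq> alphabet n \<and> word_perm a = w \<circ> t_BC (int i)} = {}"
    by blast+
  then show ?thesis
    unfolding len_BC_def by (simp only: image_empty)
qed

text \<open>Right multiplication by u_i on coefficient functions: \<open>f w\<close> is the
  coefficient of u_w, and u_v u_i is the basis element of v t_i if the length grows and 0
  otherwise.\<close>

definition demote :: "nat \<Rightarrow> nat \<Rightarrow> ((int \<Rightarrow> int) \<Rightarrow> 'k::zero) \<Rightarrow> (int \<Rightarrow> int) \<Rightarrow> 'k" where
  "demote n i f w =
     (if Suc (len_BC n (w \<circ> t_BC (int i))) = len_BC n w then f (w \<circ> t_BC (int i)) else 0)"

lemma demote_add: "demote n i (\<lambda>w. f w + g w) w = demote n i f w + demote n i g w"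
  for f :: "_ \<Rightarrow> 'k::comm_ring_1"
  by (simp add: demote_def)

lemma demote_mult: "demote n i (\<lambda>w. c * f w) w = c * demote n i f w"
  for c :: "'k::comm_ring_1"
  by (simp add: demote_def)

lemma demote_demote_same: "demote n i (demote n i f) w = 0"
  by (simp add: demote_def comp_t_BC_cancel)

lemma demote_demote:
  assumes "i < n" "j < n"
  shows "demote n i (demote n j f) w =
    (if len_BC n (w \<circ> (t_BC (int i) \<circ> t_BC (int j))) + 2 = len_BC n w
     then f (w \<circ> (t_BC (int i) \<circ> t_BC (int j))) else 0)"
  using len_BC_comp_le[OF assms(1), of w] len_BC_comp_le[OF assms(2), of "w \<circ> t_BC (int i)"]
  by (auto simp: demote_def comp_assoc)

text \<open>Multiplying by a generator changes the length by at most one, so the intermediate length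
  conditions in a product of demotions are implied by the condition on the total drop. Hence a
  product of demotions depends only on the group element and on the number of factors, which
  gives the braid relations without any exchange property.\<close>

lemma demote_demote_demote:
  assumes "i < n" "j < n" "k < n"
  shows "demote n i (demote n j (demote n k f)) w =
    (if len_BC n (w \<circ> (t_BC (int i) \<circ> t_BC (int j) \<circ> t_BC (int k))) + 3 = len_BC n w
     then f (w \<circ> (t_BC (int i) \<circ> t_BC (int j) \<circ> t_BC (int k))) else 0)"
  using len_BC_comp_le[OF assms(1), of w]
    len_BC_comp_le[OF assms(2), of "w \<circ> t_BC (int i)"]
    len_BC_comp_le[OF assms(3), of "w \<circ> t_BC (int i) \<circ> t_BC (int j)"]
  by (auto simp: demote_demote[OF assms(2,3)] demote_def[of n i] comp_assoc)

lemma demote_commute: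
  assumes "i < n" "j < n" "Suc i < j"
  shows "demote n i (demote n j f) w = demote n j (demote n i f) w"
  using assms t_BC_commute[of "int i" "int j"] by (simp add: demote_demote)

lemma demote_braid:
  assumes "0 < i" "Suc i < n"
  shows "demote n i (demote n (Suc i) (demote n i f)) w =
    demote n (Suc i) (demote n i (demote n (Suc i) f)) w"
  using assms t_BC_braid[of "int i"] by (simp add: demote_demote_demote add.commute)

definition nil_coxeter ::
    "nat \<Rightarrow> nat \<Rightarrow> 'k::comm_ring_1 \<Rightarrow> ((int \<Rightarrow> int) \<Rightarrow> 'k) \<Rightarrow> (int \<Rightarrow> int) \<Rightarrow> 'k" where
  "nil_coxeter n i x f = (\<lambda>w. f w + x * demote n i f w)"

text \<open>Additivity reflects u_i^2 = 0. This vanishing and the braid relation also match the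
  terms of the two expanded products in the Yang-Baxter equation.\<close>

interpretation nil_coxeter: yang_baxter n "nil_coxeter n"
proof
  fix i j :: nat and x y :: 'a and f :: "(int \<Rightarrow> int) \<Rightarrow> 'a"
  show "nil_coxeter n i x (nil_coxeter n i y f) = nil_coxeter n i (x + y) f"
    by (simp add: fun_eq_iff nil_coxeter_def demote_add demote_mult demote_demote_same
        algebra_simps)
  show "nil_coxeter n i x (nil_coxeter n j y f) = nil_coxeter n j y (nil_coxeter n i x f)"
    if "i < n" "j < n" "Suc i < j"
    by (simp add: fun_eq_iff nil_coxeter_def demote_add demote_mult demote_commute[OF that]
        algebra_simps)
  show "nil_coxeter n i x (nil_coxeter n (Suc i) (x + y) (nil_coxeter n i y f)) =
      nil_coxeter n (Suc i) y (nil_coxeter n i (x + y) (nil_coxeter n (Suc i) x f))"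
    if "0 < i" "Suc i < n"
    using that by (simp add: fun_eq_iff nil_coxeter_def demote_add demote_mult demote_braid
        demote_demote_same algebra_simps)
qed

section \<open>Reduced words\<close>

text \<open>Letters are restricted to \<open>A\<close>, but the length is taken in the full
  alphabet, so that both kinds of reduced words are instances.\<close>

definition reduced_words :: "nat \<Rightarrow> letter set \<Rightarrow> (int \<Rightarrow> int) \<Rightarrow> letter list set" where
  "reduced_words n A w = {a. set a \<subseteq> A \<and> word_perm a = w \<and> length a = len_BC n w}"

lemma Reduced_pm_C_eq: "Reduced_pm_C n w = reduced_words n (alphabet n) w"
proof (intro equalityI subsetI)
  fix a assume a: "a \<in> Reduced_pm_C n w"
  then obtain b where "set b \<subseteq> alphabet n" "word_perm b = w" "length b = len_BC n w"
    using len_BC_attained[of a n w] by (auto simp: Reduced_pm_C_def)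
  with a len_BC_le[of a n] show "a \<in> reduced_words n (alphabet n) w"
    by (force simp: Reduced_pm_C_def reduced_words_def)
next
  fix a assume "a \<in> reduced_words n (alphabet n) w"
  moreover have "len_BC n w \<le> length b" if "set b \<subseteq> alphabet n" "word_perm b = w" for b
    using len_BC_le[OF that(1)] that(2) by simp
  ultimately show "a \<in> Reduced_pm_C n w"
    by (simp add: Reduced_pm_C_def reduced_words_def)
qed

lemma nonneg_letters_subset: "Letter ` {0..int n - 1} \<subseteq> alphabet n"
  by (auto simp: alphabet_def)

lemma Reduced_C_eq: "Reduced_C n w = reduced_words n (Letter ` {0..int n - 1}) w"
  using nonneg_letters_subset[of n] by (auto simp: Reduced_C_def Reduced_pm_C_eq reduced_words_def)

lemma finite_alphabet: "finite (alphabet n)"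
  by (simp add: alphabet_def)

lemma finite_reduced_words:
  assumes "A \<subseteq> alphabet n"
  shows "finite (reduced_words n A w)"
proof (rule finite_subset)
  show "finite {a. set a \<subseteq> A \<and> length a = len_BC n w}"
    using assms finite_alphabet by (intro finite_lists_length_eq) (rule finite_subset)
qed (auto simp: reduced_words_def)

definition letter_index :: "letter \<Rightarrow> nat" where
  "letter_index l = nat \<bar>letter_val l\<bar>"

lemma letter_index_less: "0 < n \<Longrightarrow> l \<in> alphabet n \<Longrightarrow> letter_index l < n"
  by (auto simp: letter_index_def alphabet_def)

lemma t_BC_letter_index: "t_BC (int (letter_index l)) = t_BC (letter_val l)"
  by (simp add: letter_index_def t_BC_def)

text \<open>The lift of \<open>nil_coxeter\<close> to words: right multiplication by 1 + x l on
  noncommutative power series in the letters, \<open>\<phi> a\<close> being the coefficient of the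
  word \<open>a\<close>.\<close>

definition append_letter ::
    "letter \<Rightarrow> 'k::comm_ring_1 \<Rightarrow> (letter list \<Rightarrow> 'k) \<Rightarrow> letter list \<Rightarrow> 'k" where
  "append_letter l x \<phi> a = \<phi> a + (if a \<noteq> [] \<and> last a = l then x * \<phi> (butlast a) else 0)"

definition sum_reduced ::
    "nat \<Rightarrow> letter set \<Rightarrow> (letter list \<Rightarrow> 'k::comm_ring_1) \<Rightarrow> (int \<Rightarrow> int) \<Rightarrow> 'k" where
  "sum_reduced n A \<phi> w = (\<Sum>a \<in> reduced_words n A w. \<phi> a)"

text \<open>Deleting the last letter lowers the length by exactly one: the shortened word bounds the
  new length from above, \<open>len_BC_comp_le\<close> from below.\<close>

lemma reduced_words_last:
  assumes "0 < n" "A \<subseteq> alphabet n" "l \<in> A"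
  shows "{a \<in> reduced_words n A w. a \<noteq> [] \<and> last a = l} =
    (if Suc (len_BC n (w \<circ> t_BC (letter_val l))) = len_BC n w
     then (\<lambda>b. b @ [l]) ` reduced_words n A (w \<circ> t_BC (letter_val l)) else {})"
    (is "?lhs = ?rhs")
proof (intro equalityI subsetI)
  fix a assume a: "a \<in> ?lhs"
  then obtain b where b: "a = b @ [l]"
    by (metis (mono_tags) append_butlast_last_id mem_Collect_eq)
  with a have w: "word_perm b \<circ> t_BC (letter_val l) = w" and len: "Suc (length b) = len_BC n w"
      and A: "set b \<subseteq> A"
    by (auto simp: reduced_words_def word_perm_snoc)
  have wb: "word_perm b = w \<circ> t_BC (letter_val l)"
    by (simp only: comp_t_BC_cancel flip: w)
  have "len_BC n (w \<circ> t_BC (letter_val l)) \<le> length b"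
    using len_BC_le[of b n] A assms by (simp add: wb)
  moreover have "len_BC n w \<le> Suc (len_BC n (w \<circ> t_BC (letter_val l)))"
    using len_BC_comp_le[OF letter_index_less, of n l w] assms
    by (auto simp: t_BC_letter_index)
  ultimately show "a \<in> ?rhs"
    using len A wb b by (auto simp: reduced_words_def)
next
  fix a assume "a \<in> ?rhs"
  then show "a \<in> ?lhs"
    using assms by (auto simp: reduced_words_def word_perm_snoc comp_t_BC_cancel split: if_splits)
qed

text \<open>Splitting off the words that end in \<open>l\<close> shows that
  \<open>sum_reduced\<close> carries multiplication of word series to the nil-Coxeter algebra. Both
  sides of the theorem can thus be treated word by word.\<close>

lemma sum_reduced_append_letter:
  assumes "0 < n" "A \<subseteq> alphabet n" "l \<in> A"
  shows "sum_reduced n A (append_letter l x \<phi>) =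
    nil_coxeter n (letter_index l) x (sum_reduced n A \<phi>)"
proof
  fix w
  let ?R = "reduced_words n A"
  have "(\<Sum>a \<in> ?R w. if a \<noteq> [] \<and> last a = l then x * \<phi> (butlast a) else 0) =
      (\<Sum>a \<in> {a \<in> ?R w. a \<noteq> [] \<and> last a = l}. x * \<phi> (butlast a))"
    using finite_reduced_words[OF assms(2)] by (simp add: sum.inter_filter)
  also have "\<dots> = x * demote n (letter_index l) (sum_reduced n A \<phi>) w"
    unfolding reduced_words_last[OF assms]
    by (simp add: demote_def t_BC_letter_index sum_reduced_def sum_distrib_left sum.reindex
        inj_on_def)
  finally show "sum_reduced n A (append_letter l x \<phi>) w =
      nil_coxeter n (letter_index l) x (sum_reduced n A \<phi>) w"
    by (simp add: sum_reduced_def append_letter_def nil_coxeter_def sum.distrib)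
qed

lemma sum_reduced_fold_append_letter:
  assumes "0 < n" "A \<subseteq> alphabet n" "fst ` set ls \<subseteq> A"
  shows "sum_reduced n A (fold (\<lambda>(l, x). append_letter l x) ls \<phi>) =
    act (nil_coxeter n) (map (map_prod letter_index id) ls) (sum_reduced n A \<phi>)"
  using assms(3) by (induction ls arbitrary: \<phi>) (auto simp: sum_reduced_append_letter[OF assms(1,2)])

lemma sum_reduced_cong:
  "(\<And>a. set a \<subseteq> A \<Longrightarrow> \<phi> a = \<psi> a) \<Longrightarrow> sum_reduced n A \<phi> = sum_reduced n A \<psi>"
  by (auto simp: fun_eq_iff sum_reduced_def reduced_words_def intro!: sum.cong)

section \<open>Grading by length and uniqueness for the functional equation\<close>

lemma sum_reduced_scale:
  "sum_reduced n A (\<lambda>a. q ^ length a * \<phi> a) w = q ^ len_BC n w * sum_reduced n A \<phi> w"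
  by (auto simp: sum_reduced_def sum_distrib_left reduced_words_def intro!: sum.cong)

text \<open>Besides \<open>id\<close>, length 0 is taken by everything outside the group, where
  there are no reduced words.\<close>

lemma sum_reduced_len_0:
  assumes "len_BC n w = 0"
  shows "sum_reduced n A \<phi> w = (if w = id then \<phi> [] else 0)"
proof -
  have "reduced_words n A w = (if w = id then {[]} else {})"
    using assms by (auto simp: reduced_words_def)
  then show ?thesis
    by (simp add: sum_reduced_def)
qed

text \<open>Homogeneity, which replaces the variable z: each demotion lowers the length by one and
  brings in one parameter, hence one factor \<open>q\<close>.\<close>

lemma act_nil_coxeter_scale:
  "q ^ len_BC n w * act (nil_coxeter n) xs f w =
    act (nil_coxeter n) (map (map_prod id ((*) q)) xs) (\<lambda>w. q ^ len_BC n w * f w) w"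
proof (induction xs arbitrary: f)
  case (Cons p xs)
  obtain i x where p: "p = (i, x)" by force
  have "(\<lambda>w. q ^ len_BC n w * nil_coxeter n i x f w) =
      nil_coxeter n i (q * x) (\<lambda>w. q ^ len_BC n w * f w)"
  proof
    fix w
    have "q ^ len_BC n w = q * q ^ len_BC n (w \<circ> t_BC (int i))"
      if "Suc (len_BC n (w \<circ> t_BC (int i))) = len_BC n w"
      by (simp flip: that)
    then show "q ^ len_BC n w * nil_coxeter n i x f w =
        nil_coxeter n i (q * x) (\<lambda>w. q ^ len_BC n w * f w) w"
      by (simp add: nil_coxeter_def demote_def algebra_simps)
  qed
  then show ?case
    using Cons.IH[of "nil_coxeter n i x f"] by (simp add: p)
qed simp

text \<open>Every term of the expanded product other than the identity demotes at least once, so it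
  only reads values at smaller lengths.\<close>

lemma act_nil_coxeter_triangular:
  assumes "\<And>v. len_BC n v < len_BC n w \<Longrightarrow> f v = g v"
  shows "act (nil_coxeter n) xs f w - f w = act (nil_coxeter n) xs g w - g w"
  using assms
proof (induction xs arbitrary: f g)
  case (Cons p xs)
  obtain i x where p: "p = (i, x)" by force
  have demote: "demote n i f v = demote n i g v" if "len_BC n v \<le> len_BC n w" for v
  proof -
    have "f (v \<circ> t_BC (int i)) = g (v \<circ> t_BC (int i))"
      if "Suc (len_BC n (v \<circ> t_BC (int i))) = len_BC n v"
    proof -
      have "len_BC n (v \<circ> t_BC (int i)) < len_BC n w"
        using \<open>len_BC n v \<le> len_BC n w\<close> that by linarith
      then show ?thesis
        by (rule Cons.prems)
    qed
    then show ?thesis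
      by (simp add: demote_def)
  qed
  have "nil_coxeter n i x f v = nil_coxeter n i x g v" if "len_BC n v < len_BC n w" for v
    using Cons.prems[OF that] demote[of v] that by (simp add: nil_coxeter_def)
  from Cons.IH[OF this] have "act (nil_coxeter n) xs (nil_coxeter n i x f) w - nil_coxeter n i x f w =
      act (nil_coxeter n) xs (nil_coxeter n i x g) w - nil_coxeter n i x g w" .
  moreover have "nil_coxeter n i x f w - f w = nil_coxeter n i x g w - g w"
    by (simp add: nil_coxeter_def demote)
  \<comment> \<open>The two differences telescope to the difference for
    \<open>p # xs\<close>.\<close>
  ultimately have "(act (nil_coxeter n) xs (nil_coxeter n i x f) w - nil_coxeter n i x f w) +
      (nil_coxeter n i x f w - f w) =
      (act (nil_coxeter n) xs (nil_coxeter n i x g) w - nil_coxeter n i x g w) +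
      (nil_coxeter n i x g w - g w)"
    by (simp only:)
  then show ?case
    by (simp add: p)
qed simp

text \<open>At length \<open>p\<close> the equation expresses \<open>(q ^ p - 1) * f\<close> by values at smaller lengths.\<close>

lemma functional_equation_unique:
  fixes q :: "'k::idom"
  assumes "\<And>p. 0 < p \<Longrightarrow> q ^ p \<noteq> 1"
    and "\<And>w. q ^ len_BC n w * f w = act (nil_coxeter n) xs f w"
    and "\<And>w. q ^ len_BC n w * g w = act (nil_coxeter n) xs g w"
    and "\<And>w. len_BC n w = 0 \<Longrightarrow> f w = g w"
  shows "f w = g w"
proof (induction "len_BC n w" arbitrary: w rule: less_induct)
  case less
  show ?case
  proof (cases "len_BC n w = 0")
    case False
    have "(q ^ len_BC n w - 1) * f w = (q ^ len_BC n w - 1) * g w"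
      using act_nil_coxeter_triangular[of n w f g xs] less assms(2,3)[of w]
      by (simp add: algebra_simps)
    then show ?thesis
      using assms(1) False by simp
  qed (simp add: assms(4))
qed

section \<open>The right-hand side as a word series\<close>

lemma comaj_Nil [simp]: "comaj [] = 0"
  by (simp add: comaj_def)

lemma comaj_snoc:
  "comaj (b @ [l]) = comaj b + (if b \<noteq> [] \<and> last b < l then length b else 0)"
proof -
  have "{j. 1 \<le> j \<and> j < length (b @ [l]) \<and> (b @ [l]) ! (j - 1) < (b @ [l]) ! j} =
      {j. 1 \<le> j \<and> j < length b \<and> b ! (j - 1) < b ! j} \<union>
      (if b \<noteq> [] \<and> last b < l then {length b} else {})"
    by (cases "b = []") (auto simp: nth_append last_conv_nth less_Suc_eq Suc_le_eq split: if_splits)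
  then show ?thesis
    by (auto simp: comaj_def)
qed

definition macdonald_term :: "'k::field \<Rightarrow> letter list \<Rightarrow> 'k" where
  "macdonald_term q a = prod_list (map (\<lambda>l. q powi letter_val l + 1) a) /
     (\<Prod>j = 1..length a. q ^ j - 1) * q ^ comaj a"

lemma macdonald_term_snoc:
  assumes "\<And>p. 0 < p \<Longrightarrow> q ^ p \<noteq> 1"
  shows "(q ^ Suc (length b) - 1) * macdonald_term q (b @ [l]) =
    (q powi letter_val l + 1) * (if b \<noteq> [] \<and> last b < l then q ^ length b else 1) *
    macdonald_term q b"
proof -
  have "{1..Suc (length b)} = insert (Suc (length b)) {1..length b}"
    by auto
  then have "macdonald_term q (b @ [l]) =
      (q powi letter_val l + 1) * (if b \<noteq> [] \<and> last b < l then q ^ length b else 1) *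
      macdonald_term q b / (q ^ Suc (length b) - 1)"
    by (simp add: macdonald_term_def comaj_snoc power_add ac_simps)
  then show ?thesis
    using assms[of "Suc (length b)"] by simp
qed

text \<open>A termwise form of S(q z) = S(z) C(z) for partial products of C. The factor for the
  letter \<open>m\<close> changes only the words ending in \<open>m\<close>.\<close>

lemma macdonald_term_append_letters:
  assumes "\<And>p. 0 < p \<Longrightarrow> q ^ p \<noteq> 1" "set a \<subseteq> Letter ` {0..}"
  shows "fold (\<lambda>(l, x). append_letter l x)
      (map (\<lambda>k. (Letter (int k), q ^ k + 1)) [0..<m]) (macdonald_term q) a =
    (if a \<noteq> [] \<and> last a < Letter (int m) then q ^ length a else 1) * macdonald_term q a"
  using assms(2)
proof (induction m arbitrary: a)
  case 0
  then have "last a \<in> Letter ` {0..}" if "a \<noteq> []"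
    using last_in_set[OF that] by blast
  then have "\<not> last a < Letter 0" if "a \<noteq> []"
    using that by (force simp: less_letter_def)
  then show ?case by auto
next
  case (Suc m)
  define F where "F = fold (\<lambda>(l, x). append_letter l x)
      (map (\<lambda>k. (Letter (int k), q ^ k + 1)) [0..<m]) (macdonald_term q)"
  have IH: "F c = (if c \<noteq> [] \<and> last c < Letter (int m) then q ^ length c else 1) * macdonald_term q c"
    if "set c \<subseteq> Letter ` {0..}" for c
    unfolding F_def by (rule Suc.IH[OF that])
  have step: "fold (\<lambda>(l, x). append_letter l x)
      (map (\<lambda>k. (Letter (int k), q ^ k + 1)) [0..<Suc m]) (macdonald_term q) a =
    F a + (if a \<noteq> [] \<and> last a = Letter (int m) then (q ^ m + 1) * F (butlast a) else 0)"
    by (simp add: F_def) (simp add: append_letter_def)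
  show ?case
  proof (cases "a = []")
    case False
    then obtain b l where a: "a = b @ [l]"
      by (metis append_butlast_last_id)
    with Suc.prems obtain j where l: "l = Letter j" "0 \<le> j" and b: "set b \<subseteq> Letter ` {0..}"
      by auto
    then obtain i where j: "j = int i"
      using zero_le_imp_eq_int by blast
    have Fa: "F a = (if i < m then q ^ Suc (length b) else 1) * macdonald_term q a"
      using IH[OF Suc.prems] by (simp add: a l j less_letter_def)
    show ?thesis
    proof (cases "i = m")
      \<comment> \<open>\<open>F b\<close> carries \<open>q ^ length b\<close> exactly when
        appending \<open>m\<close> creates an ascent. By \<open>macdonald_term_snoc\<close> the new
        summand is therefore \<open>q ^ length a - 1\<close> times the term of \<open>a\<close>,
        which raises its coefficient from 1 to \<open>q ^ length a\<close>.\<close>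
      case True
      then show ?thesis
        using macdonald_term_snoc[OF assms(1), of b l]
        unfolding step Fa by (simp add: a l j less_letter_def IH[OF b] algebra_simps)
    next
      case False
      then show ?thesis
        unfolding step Fa by (simp add: a l j less_letter_def)
    qed
  next
    case True
    then show ?thesis
      unfolding step by (simp add: IH)
  qed
qed

section \<open>Generating functions of compatible sequences\<close>

unbundle fps_syntax

lemma fls_X_inv_powi: "(fls_X_inv :: 'a::field fls) powi i = fls_X_intpow (- i)"
  by (simp add: fls_inverse_X_intpow power_int_inverse flip: fls_inverse_X)

lemma fls_X_inv_powi_times_nth: "(fls_X_inv powi i * f) $$ k = f $$ (k + i)"
  for f :: "'a::field fls"
  unfolding fls_X_inv_powi fls_X_intpow_times_conv_shift by simp

text \<open>Letters decrease at equal indices because a compatible sequence may repeat an entry only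
  at a strict descent of the word.\<close>

definition seq_less :: "int \<times> letter \<Rightarrow> int \<times> letter \<Rightarrow> bool" where
  "seq_less p r \<longleftrightarrow> fst p < fst r \<or> fst p = fst r \<and> snd r < snd p"

lemma seq_less_irrefl: "\<not> seq_less p p"
  by (simp add: seq_less_def)

lemma transp_seq_less: "transp seq_less"
  by (auto simp: transp_def seq_less_def)

lemma seq_less_asym: "seq_less p r \<Longrightarrow> \<not> seq_less r p"
  by (auto simp: seq_less_def)

text \<open>A word and a compatible sequence are merged into one list of pairs sorted by
  \<^const>\<open>seq_less\<close>. Admitting a new greatest pair \<open>(i, l)\<close> then multiplies the generating function
  by one factor \<open>1 + q\<^bsup>i-1\<^esup> u\<^sub>l\<close> on the right.\<close>

definition sequences :: "(int \<times> letter) set \<Rightarrow> letter list \<Rightarrow> (int \<times> letter) list set" where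
  "sequences Q a = {ps. map snd ps = a \<and> sorted_wrt seq_less ps \<and> set ps \<subseteq> Q}"

text \<open>The exponent of q^-1 in the monomial of \<open>i\<close> after substituting q^(k-1) for
  x_k.\<close>

definition cost :: "int list \<Rightarrow> int" where
  "cost i = (\<Sum>k\<leftarrow>i. 1 - k)"

lemma cost_Nil [simp]: "cost [] = 0"
  and cost_Cons [simp]: "cost (k # i) = 1 - k + cost i"
  and cost_append [simp]: "cost (i @ j) = cost i + cost j"
  by (simp_all add: cost_def)

lemma cost_ge: "(\<And>k. k \<in> set i \<Longrightarrow> k \<le> M) \<Longrightarrow> int (length i) * (1 - M) \<le> cost i"
  by (induction i) (force simp: algebra_simps)+

text \<open>The other entries cost at least \<open>1 - M\<close> each, so a prescribed cost confines
  every entry to a finite interval.\<close>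

lemma cost_entry_ge:
  assumes "\<And>k. k \<in> set i \<Longrightarrow> k \<le> M" "k \<in> set i"
  shows "M - (cost i - int (length i) * (1 - M)) \<le> k"
proof -
  obtain i1 i2 where i: "i = i1 @ k # i2"
    using split_list[OF assms(2)] by blast
  have "int (length i1) * (1 - M) \<le> cost i1" "int (length i2) * (1 - M) \<le> cost i2"
    using assms(1) by (auto simp: i intro!: cost_ge)
  then show ?thesis
    by (simp add: i algebra_simps)
qed

lemma fst_le_of_sequences:
  "ps \<in> sequences Q a \<Longrightarrow> \<forall>p\<in>Q. fst p \<le> M \<Longrightarrow> k \<in> set (map fst ps) \<Longrightarrow> k \<le> M"
  by (auto simp: sequences_def)

lemma length_sequences: "ps \<in> sequences Q a \<Longrightarrow> length ps = length a"
  by (auto simp: sequences_def)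

lemma finite_sequences_cost:
  assumes "\<forall>p\<in>Q. fst p \<le> M"
  shows "finite {ps \<in> sequences Q a. cost (map fst ps) = k}"
proof (rule finite_subset)
  let ?B = "{M - (k - int (length a) * (1 - M))..M} \<times> set a"
  show "finite {ps. set ps \<subseteq> ?B \<and> length ps = length a}"
    by (intro finite_lists_length_eq) simp
  show "{ps \<in> sequences Q a. cost (map fst ps) = k} \<subseteq> {ps. set ps \<subseteq> ?B \<and> length ps = length a}"
  proof clarify
    fix ps assume ps: "ps \<in> sequences Q a" and k: "k = cost (map fst ps)"
    have "p \<in> ?B" if "p \<in> set ps" for p
    proof -
      have "fst p \<in> set (map fst ps)" "snd p \<in> set a"
        using that ps by (auto simp: sequences_def)
      with cost_entry_ge[of "map fst ps" M "fst p"] fst_le_of_sequences[OF ps assms]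
        length_sequences[OF ps] k
      show ?thesis
        by (cases p) auto
    qed
    with length_sequences[OF ps] k show "set ps \<subseteq> {M - (cost (map fst ps) - int (length a) * (1 - M))..M} \<times> set a \<and>
        length ps = length a"
      by auto
  qed
qed

text \<open>An upper bound \<open>M\<close> on the indices in \<open>Q\<close> makes the counted
  sets finite and the coefficients vanish in low degrees.\<close>

definition gen_fun :: "(int \<times> letter) set \<Rightarrow> letter list \<Rightarrow> rat fls" where
  "gen_fun Q a = Abs_fls (\<lambda>k. of_nat (card {ps \<in> sequences Q a. cost (map fst ps) = k}))"

lemma gen_fun_nth:
  assumes "\<forall>p\<in>Q. fst p \<le> M"
  shows "gen_fun Q a $$ k = of_nat (card {ps \<in> sequences Q a. cost (map fst ps) = k})"
  unfolding gen_fun_def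
proof (rule nth_Abs_fls_lower_bound[of "int (length a) * (1 - M)"], intro allI impI)
  fix k assume k: "k < int (length a) * (1 - M)"
  have "int (length a) * (1 - M) \<le> cost (map fst ps)" if "ps \<in> sequences Q a" for ps
    using cost_ge[of "map fst ps" M] fst_le_of_sequences[OF that assms] length_sequences[OF that]
    by simp
  with k have "{ps \<in> sequences Q a. cost (map fst ps) = k} = {}"
    by force
  then show "(of_nat (card {ps \<in> sequences Q a. cost (map fst ps) = k}) :: rat) = 0"
    by (simp only: card.empty of_nat_0)
qed

text \<open>As \<open>r\<close> exceeds all of \<open>Q\<close> and \<open>seq_less\<close> is
  irreflexive, \<open>r\<close> can occur only once and only at the end.\<close>

lemma sequences_insert:
  assumes "\<forall>p\<in>Q. seq_less p r"
  shows "sequences (insert r Q) a = sequences Q a \<union>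
    (if a \<noteq> [] \<and> last a = snd r then (\<lambda>ps. ps @ [r]) ` sequences Q (butlast a) else {})"
    (is "_ = _ \<union> ?new")
proof (intro equalityI subsetI)
  fix ps assume ps: "ps \<in> sequences (insert r Q) a"
  show "ps \<in> sequences Q a \<union> ?new"
  proof (cases "r \<in> set ps")
    case False
    with ps show ?thesis by (auto simp: sequences_def)
  next
    case True
    then obtain ps' p where p: "ps = ps' @ [p]"
      by (metis append_butlast_last_id list.set_cases list.distinct(1))
    have "set ps' \<subseteq> Q"
    proof
      fix x assume x: "x \<in> set ps'"
      with ps have "x \<in> insert r Q" "p \<in> insert r Q" "seq_less x p"
        by (auto simp: p sequences_def sorted_wrt_append)
      with assms seq_less_asym show "x \<in> Q"
        using seq_less_irrefl by blast
    qed
    moreover have "p = r"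
      using True \<open>set ps' \<subseteq> Q\<close> assms seq_less_irrefl[of r] by (auto simp: p)
    ultimately have "ps' \<in> sequences Q (butlast a)" "a \<noteq> []" "last a = snd r"
      using ps by (auto simp: p sequences_def sorted_wrt_append map_butlast)
    then show ?thesis
      using \<open>p = r\<close> by (auto simp: p)
  qed
next
  fix ps assume "ps \<in> sequences Q a \<union> ?new"
  then show "ps \<in> sequences (insert r Q) a"
  proof
    assume "ps \<in> ?new"
    then obtain ps' where "a \<noteq> []" "last a = snd r" "ps' \<in> sequences Q (butlast a)" "ps = ps' @ [r]"
      by (auto split: if_splits)
    moreover from this have "map snd ps = a"
      by (auto simp: sequences_def) (metis append_butlast_last_id)
    ultimately show ?thesis
      using assms by (auto simp: sequences_def sorted_wrt_append)
  qed (auto simp: sequences_def)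
qed

lemma gen_fun_insert:
  assumes "\<forall>p\<in>Q. fst p \<le> M" "\<forall>p\<in>Q. seq_less p r"
  shows "gen_fun (insert r Q) = append_letter (snd r) (q_fls powi (fst r - 1)) (gen_fun Q)"
proof (intro ext fls_eqI)
  fix a k
  let ?S = "\<lambda>Q a k. {ps \<in> sequences Q a. cost (map fst ps) = k}"
  have bound: "\<forall>p\<in>insert r Q. fst p \<le> max M (fst r)"
    using assms(1) by auto
  show "gen_fun (insert r Q) a $$ k = append_letter (snd r) (q_fls powi (fst r - 1)) (gen_fun Q) a $$ k"
  proof (cases "a \<noteq> [] \<and> last a = snd r")
    case False
    then show ?thesis
      unfolding gen_fun_nth[OF bound] append_letter_def sequences_insert[OF assms(2)]
      by (auto simp: gen_fun_nth[OF assms(1)])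
  next
    case True
    \<comment> \<open>Removing the final pair \<open>r\<close> lowers the cost by
      \<open>1 - fst r\<close>.\<close>
    let ?k = "k + (fst r - 1)"
    have "?S (insert r Q) a k = ?S Q a k \<union> (\<lambda>ps. ps @ [r]) ` ?S Q (butlast a) ?k"
      using True by (auto simp: sequences_insert[OF assms(2)])
    moreover have "r \<notin> Q"
      using assms(2) seq_less_irrefl by blast
    then have "ps @ [r] \<notin> sequences Q a" for ps
      by (simp add: sequences_def)
    then have "?S Q a k \<inter> (\<lambda>ps. ps @ [r]) ` ?S Q (butlast a) ?k = {}"
      by blast
    ultimately have "card (?S (insert r Q) a k) = card (?S Q a k) + card (?S Q (butlast a) ?k)"
      by (simp add: card_Un_disjoint finite_sequences_cost[OF assms(1)] card_image inj_on_def)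
    then show ?thesis
      using True unfolding gen_fun_nth[OF bound]
      by (simp add: append_letter_def fls_X_inv_powi_times_nth gen_fun_nth[OF assms(1)])
  qed
qed

lemma gen_fun_Un:
  assumes "\<forall>p\<in>Q. fst p \<le> M" "\<forall>p\<in>Q. \<forall>r\<in>set rs. seq_less p r" "sorted_wrt seq_less rs"
  shows "gen_fun (Q \<union> set rs) =
    fold (\<lambda>(l, x). append_letter l x) (map (\<lambda>(i, l). (l, q_fls powi (i - 1))) rs) (gen_fun Q)"
  using assms
proof (induction rs arbitrary: Q M)
  case (Cons r rs)
  have "gen_fun (insert r Q \<union> set rs) = fold (\<lambda>(l, x). append_letter l x)
      (map (\<lambda>(i, l). (l, q_fls powi (i - 1))) rs) (gen_fun (insert r Q))"
    by (rule Cons.IH[of _ "max M (fst r)"]) (use Cons.prems in auto)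
  moreover have "gen_fun (insert r Q) = append_letter (snd r) (q_fls powi (fst r - 1)) (gen_fun Q)"
    by (rule gen_fun_insert) (use Cons.prems in auto)
  ultimately show ?case
    by (cases r) simp
qed simp

lemma sequences_shift:
  "sequences (map_prod (\<lambda>i. i + 1) id ` Q) a = map (map_prod (\<lambda>i. i + 1) id) ` sequences Q a"
    (is "?lhs = map ?s ` _")
proof (intro equalityI subsetI)
  have less: "seq_less (?s p) (?s r) \<longleftrightarrow> seq_less p r" for p r
    by (auto simp: seq_less_def)
  have less': "seq_less (map_prod (\<lambda>i. i - 1) id p) (map_prod (\<lambda>i. i - 1) id r) \<longleftrightarrow> seq_less p r"
    for p r
    by (auto simp: seq_less_def)
  {
    fix ps assume ps: "ps \<in> ?lhs"
    let ?ps' = "map (map_prod (\<lambda>i. i - 1) id) ps"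
    have ps': "ps = map ?s ?ps'"
      by (simp add: comp_def map_prod_def case_prod_beta)
    moreover have "?ps' \<in> sequences Q a"
      using ps by (auto simp: sequences_def sorted_wrt_map less' comp_def)
    ultimately show "ps \<in> map ?s ` sequences Q a"
      by blast
  }
  fix ps assume "ps \<in> map ?s ` sequences Q a"
  then obtain ps' where "ps = map ?s ps'" "ps' \<in> sequences Q a"
    by blast
  moreover from this have "?s ` set ps' \<subseteq> ?s ` Q"
    by (intro image_mono) (simp add: sequences_def)
  ultimately show "ps \<in> ?lhs"
    by (auto simp: sequences_def sorted_wrt_map less)
qed

lemma cost_shift: "cost (map (\<lambda>k. k + 1) i) = cost i - int (length i)"
  by (induction i) auto

text \<open>Raising all indices by one multiplies every variable by \<open>q\<close>; this is the
  passage from z to q z.\<close>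

lemma gen_fun_shift:
  assumes "\<forall>p\<in>Q. fst p \<le> M"
  shows "gen_fun (map_prod (\<lambda>i. i + 1) id ` Q) a = q_fls ^ length a * gen_fun Q a"
proof (rule fls_eqI)
  fix k
  let ?s = "map_prod (\<lambda>i. i + 1) id :: int \<times> letter \<Rightarrow> _"
  have bound: "\<forall>p\<in>?s ` Q. fst p \<le> M + 1"
    using assms by auto
  have inj_s: "inj ?s"
    by (auto simp: inj_def)
  have cost: "cost (map fst (map ?s ps)) = cost (map fst ps) - int (length a)"
    if "ps \<in> sequences Q a" for ps
    using cost_shift[of "map fst ps"] length_sequences[OF that] by (simp add: comp_def)
  have "{ps \<in> sequences (?s ` Q) a. cost (map fst ps) = k} =
      map ?s ` {ps \<in> sequences Q a. cost (map fst (map ?s ps)) = k}"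
    unfolding sequences_shift by blast
  also have "{ps \<in> sequences Q a. cost (map fst (map ?s ps)) = k} =
      {ps \<in> sequences Q a. cost (map fst ps) = k + int (length a)}"
    by (intro Collect_cong conj_cong refl, subst cost) auto
  finally have "card {ps \<in> sequences (?s ` Q) a. cost (map fst ps) = k} =
      card {ps \<in> sequences Q a. cost (map fst ps) = k + int (length a)}"
    by (simp only: card_image[OF inj_on_subset[OF inj_mapI subset_UNIV]] inj_s)
  then show "gen_fun (?s ` Q) a $$ k = (q_fls ^ length a * gen_fun Q a) $$ k"
    unfolding gen_fun_nth[OF bound]
    by (simp add: gen_fun_nth[OF assms] fls_X_inv_power_times_conv_shift)
qed

lemma gen_fun_Nil: "gen_fun Q [] = 1"
proof (rule fls_eqI)
  fix k
  have "sequences Q [] = {[]}"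
    by (auto simp: sequences_def)
  then have "{ps \<in> sequences Q []. cost (map fst ps) = k} = (if k = 0 then {[]} else {})" for k
    by (simp add: set_eq_iff) (metis cost_Nil list.map(1))
  then have card: "card {ps \<in> sequences Q []. cost (map fst ps) = k} = (if k = 0 then 1 else 0)" for k
    by simp
  show "gen_fun Q [] $$ k = 1 $$ k"
    unfolding gen_fun_def card by (subst nth_Abs_fls_lower_bound[of 0]) simp_all
qed

section \<open>The specialization\<close>

definition bounded_pairs :: "nat \<Rightarrow> (int \<times> letter) set" where
  "bounded_pairs n = {(i, l). l \<in> alphabet n \<and> (0 < i \<longrightarrow> Letter i \<le> l)}"

text \<open>These pairs account for the infinite product of B(q^-1), B(q^-2) and so on. It is never
  formed; only its behaviour under a shift of the indices is used.\<close>

definition nonpos_pairs :: "nat \<Rightarrow> (int \<times> letter) set" where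
  "nonpos_pairs n = {(i, l). l \<in> alphabet n \<and> i \<le> 0}"

lemma Compatible_eq_sequences:
  assumes "set a \<subseteq> alphabet n"
  shows "Compatible a = map fst ` sequences (bounded_pairs n) a"
proof (intro equalityI subsetI)
  fix i assume i: "i \<in> Compatible a"
  then have len: "length i = length a"
    by (simp add: Compatible_def)
  have "sorted_wrt seq_less (zip i a)"
    using i unfolding sorted_wrt_iff_nth_Suc_transp[OF transp_seq_less]
    by (auto simp: Compatible_def seq_less_def sorted_iff_nth_Suc)
  moreover have "set (zip i a) \<subseteq> bounded_pairs n"
    using i subsetD[OF assms nth_mem] by (auto simp: Compatible_def bounded_pairs_def in_set_zip)
  ultimately have "zip i a \<in> sequences (bounded_pairs n) a"
    using len by (simp add: sequences_def)
  moreover have "i = map fst (zip i a)"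
    using len by simp
  ultimately show "i \<in> map fst ` sequences (bounded_pairs n) a"
    by blast
next
  fix i assume "i \<in> map fst ` sequences (bounded_pairs n) a"
  then obtain ps where ps: "ps \<in> sequences (bounded_pairs n) a" and i: "i = map fst ps"
    by blast
  then have a: "a = map snd ps"
    by (simp add: sequences_def)
  have step: "seq_less (ps ! j) (ps ! Suc j)" if "Suc j < length ps" for j
    using ps that sorted_wrt_iff_nth_Suc_transp[OF transp_seq_less, of ps]
    by (simp add: sequences_def)
  have "ps ! j \<in> bounded_pairs n" if "j < length ps" for j
    using ps that nth_mem by (fastforce simp: sequences_def)
  then show "i \<in> Compatible a"
    using step by (fastforce simp: Compatible_def i a sorted_iff_nth_Suc seq_less_def bounded_pairs_def)
qed

lemma inj_on_map_fst_sequences: "inj_on (map fst) (sequences Q a)"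
  by (rule inj_onI) (metis (mono_tags) mem_Collect_eq sequences_def zip_map_fst_snd)

lemma bounded_pairs_fst_le: "0 < n \<Longrightarrow> \<forall>p\<in>bounded_pairs n. fst p \<le> int n - 1"
  by (force simp: bounded_pairs_def alphabet_def less_eq_letter_def)

lemma gen_fun_nth_Compatible:
  assumes "0 < n" "set a \<subseteq> alphabet n"
  shows "finite {i \<in> Compatible a. cost i = k}"
    and "gen_fun (bounded_pairs n) a $$ k = of_nat (card {i \<in> Compatible a. cost i = k})"
proof -
  let ?S = "{ps \<in> sequences (bounded_pairs n) a. cost (map fst ps) = k}"
  have eq: "{i \<in> Compatible a. cost i = k} = map fst ` ?S"
    unfolding Compatible_eq_sequences[OF assms(2)] by blast
  then show "finite {i \<in> Compatible a. cost i = k}"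
    using finite_sequences_cost[OF bounded_pairs_fst_le[OF assms(1)]] by simp
  have "inj_on (map fst) ?S"
    by (rule inj_on_subset[OF inj_on_map_fst_sequences]) blast
  then show "gen_fun (bounded_pairs n) a $$ k = of_nat (card {i \<in> Compatible a. cost i = k})"
    unfolding gen_fun_nth[OF bounded_pairs_fst_le[OF assms(1)]] eq by (simp add: card_image)
qed

lemma cost_ge_Compatible:
  assumes "0 < n" "set a \<subseteq> alphabet n" "i \<in> Compatible a"
  shows "int (length a) * (2 - int n) \<le> cost i"
proof -
  obtain ps where "ps \<in> sequences (bounded_pairs n) a" "i = map fst ps"
    using assms(2,3) Compatible_eq_sequences by blast
  then show ?thesis
    using cost_ge[of i "int n - 1"] fst_le_of_sequences[OF _ bounded_pairs_fst_le[OF assms(1)]]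
      length_sequences[of ps "bounded_pairs n" a] by auto
qed

section \<open>Evaluation of monomials\<close>

definition mon_cost :: "monomial \<Rightarrow> int" where
  "mon_cost m = (\<Sum>i \<in> Poly_Mapping.keys m. (1 - i) * int (Poly_Mapping.lookup m i))"

lemma mon_cost_superset:
  "finite A \<Longrightarrow> Poly_Mapping.keys m \<subseteq> A \<Longrightarrow>
    mon_cost m = (\<Sum>i \<in> A. (1 - i) * int (Poly_Mapping.lookup m i))"
  unfolding mon_cost_def by (rule sum.mono_neutral_left) (auto simp: in_keys_iff)

lemma mon_cost_add: "mon_cost (m1 + m2) = mon_cost m1 + mon_cost m2"
proof -
  let ?A = "Poly_Mapping.keys m1 \<union> Poly_Mapping.keys m2"
  have "mon_cost m = (\<Sum>i \<in> ?A. (1 - i) * int (Poly_Mapping.lookup m i))"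
    if "m \<in> {m1, m2, m1 + m2}" for m
    using that Poly_Mapping.keys_add[of m1 m2] by (intro mon_cost_superset) auto
  then show ?thesis
    by (simp add: lookup_add distrib_left sum.distrib)
qed

lemma mon_cost_x_mon: "mon_cost (x_mon i) = cost i"
proof (induction i)
  case (Cons k i)
  have "x_mon (k # i) = Poly_Mapping.single k 1 + x_mon i"
    by (simp add: x_mon_def)
  moreover have "mon_cost (Poly_Mapping.single k 1) = 1 - k"
    by (simp add: mon_cost_def)
  ultimately show ?case
    by (simp add: mon_cost_add Cons)
qed (simp add: x_mon_def mon_cost_def)

lemma fls_X_inv_powi_prod:
  "(\<Prod>i \<in> A. (fls_X_inv :: 'a::field fls) powi f i) = fls_X_inv powi (\<Sum>i \<in> A. f i)"
  by (induction A rule: infinite_finite_induct) (simp_all add: power_int_add)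

lemma eval_term_nth:
  "eval_term (\<lambda>i. q_fls powi (i - 1)) F m $$ k = (if mon_cost m = k then of_int (F m) else 0)"
proof -
  have "(\<Prod>i \<in> Poly_Mapping.keys m. (q_fls powi (i - 1)) ^ Poly_Mapping.lookup m i) =
      q_fls powi (\<Sum>i \<in> Poly_Mapping.keys m. (i - 1) * int (Poly_Mapping.lookup m i))"
    by (simp add: power_int_power' fls_X_inv_powi_prod)
  also have "(\<Sum>i \<in> Poly_Mapping.keys m. (i - 1) * int (Poly_Mapping.lookup m i)) = - mon_cost m"
    by (simp add: mon_cost_def algebra_simps sum_subtractf)
  finally have "eval_term (\<lambda>i. q_fls powi (i - 1)) F m = of_int (F m) * fls_X_intpow (mon_cost m)"
    by (simp add: eval_term_def fls_X_inv_powi)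
  then show ?thesis
    by (auto simp: fls_of_int)
qed

text \<open>All words for \<open>w\<close> have the same length and their compatible sequences have
  entries below \<open>n\<close>, so costs are bounded below. Summing over the monomials of one cost
  regroups compatible sequences by cost.\<close>

lemma subst_S_C:
  assumes "0 < n"
  shows "substitutable (\<lambda>i. q_fls powi (i - 1)) (S_C n w)"
    and "subst_series (\<lambda>i. q_fls powi (i - 1)) (S_C n w) =
      sum_reduced n (alphabet n) (gen_fun (bounded_pairs n)) w"
proof -
  let ?R = "reduced_words n (alphabet n) w"
  let ?e = "eval_term (\<lambda>i. q_fls powi (i - 1)) (S_C n w)"
  \<comment> \<open>\<open>M k\<close> is a finite set containing all monomials that contribute to
    degree \<open>k\<close>, and \<open>N\<close> is a lower bound for all degrees that
    occur.\<close>
  define M where "M k = x_mon ` (\<Union>a \<in> ?R. {i \<in> Compatible a. cost i = k})" for k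
  define N where "N = int (len_BC n w) * (2 - int n)"
  have R: "set a \<subseteq> alphabet n" "length a = len_BC n w" if "a \<in> ?R" for a
    using that by (auto simp: reduced_words_def)
  have finR: "finite ?R"
    by (rule finite_reduced_words) simp
  have finM: "finite (M k)" for k
    unfolding M_def using finR R gen_fun_nth_Compatible(1)[OF assms] by auto
  have supp: "m \<in> M k" if nz: "?e m $$ k \<noteq> 0" for m k
  proof -
    have k: "mon_cost m = k" and "S_C n w m \<noteq> 0"
      using nz by (auto simp: eval_term_nth split: if_splits)
    then have "(\<Sum>a \<in> ?R. int (card {i \<in> Compatible a. x_mon i = m})) \<noteq> 0"
      by (simp add: S_C_def Reduced_pm_C_eq)
    then obtain a where a: "a \<in> ?R" "int (card {i \<in> Compatible a. x_mon i = m}) \<noteq> 0"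
      by (rule sum.not_neutral_contains_not_neutral)
    then have "{i \<in> Compatible a. x_mon i = m} \<noteq> {}"
      by (metis card.empty of_nat_0)
    then obtain i where "i \<in> Compatible a" "x_mon i = m"
      by blast
    moreover from this k have "cost i = k"
      by (simp flip: mon_cost_x_mon)
    ultimately show ?thesis
      using a(1) unfolding M_def by blast
  qed
  have bound: "?e m $$ k = 0" if k: "k < N" for m k
  proof (rule ccontr)
    assume "?e m $$ k \<noteq> 0"
    from supp[OF this] obtain a i where "a \<in> ?R" "i \<in> Compatible a" "cost i = k"
      by (auto simp: M_def)
    with cost_ge_Compatible[OF assms R(1)] R(2) k show False
      by (force simp: N_def)
  qed
  have "finite {m. ?e m $$ k \<noteq> 0}" for k
    by (rule finite_subset[OF _ finM[of k]]) (use supp in blast)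
  with bound show "substitutable (\<lambda>i. q_fls powi (i - 1)) (S_C n w)"
    unfolding substitutable_def fls_summable_def by blast
  have coeff: "(\<Sum>m | ?e m $$ k \<noteq> 0. ?e m $$ k) =
      sum_reduced n (alphabet n) (gen_fun (bounded_pairs n)) w $$ k" for k
  proof -
    have "(\<Sum>m | ?e m $$ k \<noteq> 0. ?e m $$ k) = (\<Sum>m \<in> M k. ?e m $$ k)"
      by (rule sum.mono_neutral_left) (use supp finM in auto)
    also have "\<dots> = (\<Sum>m \<in> M k. of_int (S_C n w m))"
      by (rule sum.cong) (auto simp: M_def eval_term_nth mon_cost_x_mon)
    also have "\<dots> = (\<Sum>m \<in> M k. \<Sum>a \<in> ?R. of_nat (card {i \<in> Compatible a. x_mon i = m}))"
      by (simp add: S_C_def Reduced_pm_C_eq)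
    also have "\<dots> = (\<Sum>a \<in> ?R. \<Sum>m \<in> M k. of_nat (card {i \<in> Compatible a. x_mon i = m}))"
      by (rule sum.swap)
    also have "\<dots> = (\<Sum>a \<in> ?R. of_nat (card {i \<in> Compatible a. cost i = k}))"
    proof (rule sum.cong[OF refl])
      fix a assume a: "a \<in> ?R"
      let ?C = "{i \<in> Compatible a. cost i = k}"
      have fin: "finite ?C"
        by (rule gen_fun_nth_Compatible(1)[OF assms R(1)[OF a]])
      have "{i \<in> Compatible a. x_mon i = m} = {i \<in> ?C. x_mon i = m}" if "m \<in> M k" for m
        using that by (auto simp: M_def mon_cost_x_mon simp flip: mon_cost_x_mon)
      then have "(\<Sum>m \<in> M k. card {i \<in> Compatible a. x_mon i = m}) =
          (\<Sum>m \<in> M k. \<Sum>i \<in> {i \<in> ?C. x_mon i = m}. 1)"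
        by simp
      also have "\<dots> = card ?C"
        by (subst sum.group[OF fin finM]) (use a in \<open>auto simp: M_def\<close>)
      finally show "(\<Sum>m \<in> M k. of_nat (card {i \<in> Compatible a. x_mon i = m})) =
          (of_nat (card ?C) :: rat)"
        by (simp flip: of_nat_sum)
    qed
    also have "\<dots> = sum_reduced n (alphabet n) (gen_fun (bounded_pairs n)) w $$ k"
      using R gen_fun_nth_Compatible(2)[OF assms] by (simp add: sum_reduced_def fls_nth_sum)
    finally show ?thesis .
  qed
  show "subst_series (\<lambda>i. q_fls powi (i - 1)) (S_C n w) =
      sum_reduced n (alphabet n) (gen_fun (bounded_pairs n)) w"
  proof (rule fls_eqI)
    fix k
    show "subst_series (\<lambda>i. q_fls powi (i - 1)) (S_C n w) $$ k =
        sum_reduced n (alphabet n) (gen_fun (bounded_pairs n)) w $$ k"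
      unfolding subst_series_def fls_sum_def coeff[symmetric]
      by (rule nth_Abs_fls_lower_bound[of N]) (simp add: bound)
  qed
qed

section \<open>Factorization into ascending and descending runs\<close>

definition signed_letters :: "nat \<Rightarrow> letter list" where
  "signed_letters n = rev (map (\<lambda>k. Letter (int k)) [0..<n]) @
     NegZero # map (\<lambda>k. Letter (- int k)) [1..<n]"

lemma set_signed_letters:
  assumes "0 < n"
  shows "set (signed_letters n) = alphabet n"
proof -
  have "{- int n + 1..int n - 1} = int ` {0..<n} \<union> (\<lambda>k. - int k) ` {1..<n}"
  proof (intro equalityI subsetI)
    fix i assume i: "i \<in> {- int n + 1..int n - 1}"
    then show "i \<in> int ` {0..<n} \<union> (\<lambda>k. - int k) ` {1..<n}"
    proof (cases i rule: int_cases2)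
      case (nonpos k)
      with i assms show ?thesis
        by (cases "k = 0") auto
    qed auto
  qed (use assms in auto)
  then show ?thesis
    by (auto simp: signed_letters_def alphabet_def image_Un image_image)
qed

lemma sorted_signed_letters: "sorted_wrt (>) (signed_letters n)"
  by (auto simp: signed_letters_def sorted_wrt_append rev_map[symmetric] sorted_wrt_rev sorted_wrt_map
      less_letter_def intro!: sorted_wrt_mono_rel[OF _ sorted_wrt_upt])

text \<open>Source of the functional equation: admitting index 1, which multiplies by B(1), has the
  same effect as shifting all nonpositive indices.\<close>

lemma nonpos_pairs_shift:
  assumes "0 < n"
  shows "nonpos_pairs n \<union> set (map (Pair 1) (signed_letters n)) =
    map_prod (\<lambda>i. i + 1) id ` nonpos_pairs n"
proof -
  have "p \<in> map_prod (\<lambda>i. i + 1) id ` nonpos_pairs n \<longleftrightarrow> snd p \<in> alphabet n \<and> fst p \<le> 1" for p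
    by (force simp: nonpos_pairs_def intro: image_eqI[of _ _ "(fst p - 1, snd p)"])
  then show ?thesis
    by (auto simp: set_signed_letters[OF assms] nonpos_pairs_def)
qed

text \<open>Listed in the order \<open>seq_less\<close>; index \<open>i\<close> contributes the run
  A_i(q^(i-1)).\<close>

definition positive_pairs :: "nat \<Rightarrow> (int \<times> letter) list" where
  "positive_pairs n = concat (map (\<lambda>i. rev (map (\<lambda>k. (int i, Letter (int k))) [i..<n])) [1..<n])"

lemma bounded_pairs_eq: "bounded_pairs n = nonpos_pairs n \<union> set (positive_pairs n)"
proof -
  have "(i, l) \<in> set (positive_pairs n) \<longleftrightarrow> l \<in> alphabet n \<and> 0 < i \<and> Letter i \<le> l" for i l
  proof
    assume "l \<in> alphabet n \<and> 0 < i \<and> Letter i \<le> l"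
    then obtain k where "l = Letter k" "i \<le> k" "k < int n" "0 < i"
      by (auto simp: alphabet_def less_eq_letter_def)
    then show "(i, l) \<in> set (positive_pairs n)"
      by (force simp: positive_pairs_def intro!: bexI[of _ "nat i"] image_eqI[of _ _ "nat k"])
  qed (auto simp: positive_pairs_def alphabet_def less_eq_letter_def)
  then show ?thesis
    by (auto simp: bounded_pairs_def nonpos_pairs_def)
qed

lemma sorted_wrt_concat:
  assumes "\<And>xs. xs \<in> set xss \<Longrightarrow> sorted_wrt R xs"
    and "sorted_wrt (\<lambda>xs ys. \<forall>x\<in>set xs. \<forall>y\<in>set ys. R x y) xss"
  shows "sorted_wrt R (concat xss)"
  using assms by (induction xss) (auto simp: sorted_wrt_append)

lemma sorted_positive_pairs: "sorted_wrt seq_less (positive_pairs n)"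
  unfolding positive_pairs_def
proof (rule sorted_wrt_concat)
  show "sorted_wrt (\<lambda>xs ys. \<forall>x\<in>set xs. \<forall>y\<in>set ys. seq_less x y)
      (map (\<lambda>i. rev (map (\<lambda>k. (int i, Letter (int k))) [i..<n])) [1..<n])"
    unfolding sorted_wrt_map
    by (rule sorted_wrt_mono_rel[OF _ sorted_wrt_upt]) (auto simp: seq_less_def)
qed (auto simp: rev_map[symmetric] sorted_wrt_rev sorted_wrt_map seq_less_def less_letter_def
      intro!: sorted_wrt_mono_rel[OF _ sorted_wrt_upt])

lemma sum_reduced_gen_fun_functional_equation:
  assumes "0 < n"
  defines "f \<equiv> sum_reduced n (alphabet n) (gen_fun (bounded_pairs n))"
  shows "q_fls ^ len_BC n w * f w =
    act (nil_coxeter n) (map (\<lambda>k. (k, q_fls ^ k + 1)) [0..<n]) f w"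
proof -
  let ?act = "act (nil_coxeter n)"
  let ?P = "concat (map (\<lambda>k. descending n (q_fls ^ (k - 1)) k) [1..<n])"
    and ?P' = "concat (map (\<lambda>k. descending n (q_fls ^ k) k) [1..<n])"
    and ?B = "descending n 1 0 @ ascending n 1 0 :: (nat \<times> rat fls) list"
    and ?C = "map (\<lambda>k. (k, q_fls ^ k + 1)) [0..<n]"
  let ?wt = "\<lambda>rs. map (map_prod letter_index id) (map (\<lambda>(i, l). (l, q_fls powi (i - 1))) rs)"
  define g where "g = sum_reduced n (alphabet n) (gen_fun (nonpos_pairs n))"
  have nonpos: "\<forall>p\<in>nonpos_pairs n. fst p \<le> 0"
    by (auto simp: nonpos_pairs_def)
  have adjoin: "sum_reduced n (alphabet n) (gen_fun (nonpos_pairs n \<union> set rs)) = ?act (?wt rs) g"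
    if "sorted_wrt seq_less rs" "\<forall>r\<in>set rs. 0 < fst r \<and> snd r \<in> alphabet n" for rs
  proof -
    have "\<forall>p\<in>nonpos_pairs n. \<forall>r\<in>set rs. seq_less p r"
      using that(2) by (force simp: nonpos_pairs_def seq_less_def)
    from gen_fun_Un[OF nonpos this that(1)] have adjoined: "gen_fun (nonpos_pairs n \<union> set rs) =
        fold (\<lambda>(l, x). append_letter l x) (map (\<lambda>(i, l). (l, q_fls powi (i - 1))) rs)
          (gen_fun (nonpos_pairs n))" .
    show ?thesis
      unfolding adjoined g_def
      using assms(1) that(2) by (subst sum_reduced_fold_append_letter) auto
  qed
  have "f = ?act (?wt (positive_pairs n)) g"
    unfolding f_def bounded_pairs_eq using sorted_positive_pairs
    by (rule adjoin) (auto simp: positive_pairs_def alphabet_def)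
  also have "?wt (positive_pairs n) = ?P"
    by (auto simp: positive_pairs_def descending_def ascending_def map_concat rev_map letter_index_def
        comp_def of_nat_diff simp flip: power_int_of_nat intro!: arg_cong[of _ _ concat])
  finally have f: "f = ?act ?P g" .
  have "(\<lambda>w. q_fls ^ len_BC n w * g w) =
      sum_reduced n (alphabet n) (gen_fun (nonpos_pairs n \<union> set (map (Pair 1) (signed_letters n))))"
    unfolding g_def nonpos_pairs_shift[OF assms(1)] gen_fun_shift[OF nonpos]
    by (simp add: fun_eq_iff flip: sum_reduced_scale)
  also have "\<dots> = ?act (?wt (map (Pair 1) (signed_letters n))) g"
    by (rule adjoin)
      (auto simp: sorted_wrt_map seq_less_def sorted_signed_letters set_signed_letters[OF assms(1)])
  \<comment> \<open>\<open>Letter 0\<close> and \<open>NegZero\<close> both have index 0 and give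
    the two middle factors of B(1).\<close>
  also have "?wt (map (Pair 1) (signed_letters n)) = ?B"
    using assms(1) by (simp add: signed_letters_def descending_def ascending_def letter_index_def
        comp_def rev_map upt_conv_Cons)
  finally have g: "(\<lambda>w. q_fls ^ len_BC n w * g w) = ?act ?B g" .
  have scale: "map (map_prod id ((*) q_fls)) ?P = ?P'"
    by (auto simp: descending_def ascending_def map_concat rev_map comp_def
        simp flip: power_Suc intro!: arg_cong[of _ _ concat])
  \<comment> \<open>Homogeneity distributes the factor \<open>q_fls ^ len_BC n w\<close> over the
    staircase, which becomes \<open>?P'\<close>, and over \<open>g\<close>, which absorbs
    B(1).\<close>
  have "q_fls ^ len_BC n w * f w = ?act ?P' (\<lambda>w. q_fls ^ len_BC n w * g w) w"
    unfolding f act_nil_coxeter_scale scale ..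
  also have "\<dots> = ?act (?B @ ?P') g w"
    by (simp only: g act_append)
  also have "\<dots> = ?act (?P @ ?C) g w"
    by (simp only: nil_coxeter.staircase_functional_equation[OF assms(1)])
  also have "\<dots> = ?act ?C f w"
    by (simp only: f act_append)
  finally show ?thesis .
qed

text \<open>With all \<open>n\<close> factors present, every nonempty word over the nonnegative
  letters ends below \<open>Letter (int n)\<close>, so each term acquires the full power of
  \<open>q\<close>.\<close>

lemma sum_reduced_macdonald_functional_equation:
  fixes q :: "'k::field"
  assumes "0 < n" "\<And>p. 0 < p \<Longrightarrow> q ^ p \<noteq> 1"
  defines "f \<equiv> sum_reduced n (Letter ` {0..int n - 1}) (macdonald_term q)"
  shows "q ^ len_BC n w * f w = act (nil_coxeter n) (map (\<lambda>k. (k, q ^ k + 1)) [0..<n]) f w"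
proof -
  let ?A = "Letter ` {0..int n - 1}"
  let ?ls = "map (\<lambda>k. (Letter (int k), q ^ k + 1)) [0..<n]"
  have "q ^ length a * macdonald_term q a =
      fold (\<lambda>(l, x). append_letter l x) ?ls (macdonald_term q) a" if a: "set a \<subseteq> ?A" for a
  proof -
    have "last a < Letter (int n)" if "a \<noteq> []"
      using last_in_set[OF that] a by (auto simp: less_letter_def)
    moreover have "set a \<subseteq> Letter ` {0..}"
      using a by auto
    ultimately show ?thesis
      by (cases "a = []") (simp_all add: macdonald_term_append_letters[OF assms(2)])
  qed
  then have "q ^ len_BC n w * f w =
      sum_reduced n ?A (fold (\<lambda>(l, x). append_letter l x) ?ls (macdonald_term q)) w"
    unfolding f_def sum_reduced_scale[symmetric] by (intro fun_cong[OF sum_reduced_cong])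
  also have "\<dots> = act (nil_coxeter n) (map (map_prod letter_index id) ?ls) f w"
    unfolding f_def
    by (rule fun_cong[OF sum_reduced_fold_append_letter[OF assms(1) nonneg_letters_subset]]) auto
  also have "map (map_prod letter_index id) ?ls = map (\<lambda>k. (k, q ^ k + 1)) [0..<n]"
    by (simp add: letter_index_def comp_def)
  finally show ?thesis .
qed

lemma fls_X_inv_power_neq_1:
  assumes "0 < p"
  shows "(fls_X_inv :: 'a::field fls) ^ p \<noteq> 1"
proof
  assume "(fls_X_inv :: 'a fls) ^ p = 1"
  then have "(fls_X_inv ^ p :: 'a fls) $$ 0 = 1 $$ 0"
    by (rule arg_cong)
  with assms show False by simp
qed

theorem theorem1p8:
  fixes n :: nat and w :: "int \<Rightarrow> int"
  assumes "0 < n" and "w \<in> W_BC n"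
  shows "substitutable (\<lambda>i. q_fls powi (i - 1)) (S_C n w) \<and>
    subst_series (\<lambda>i. q_fls powi (i - 1)) (S_C n w) =
      (\<Sum>a \<in> Reduced_C n w.
         prod_list (map (\<lambda>l. q_fls powi letter_val l + 1) a) /
         (\<Prod>j = 1..length a. q_fls ^ j - 1) * q_fls ^ comaj a)"
proof -
  \<comment> \<open>Both sides solve the same functional equation; at length 0 they have the value 1
    at \<open>id\<close> and 0 elsewhere.\<close>
  have "sum_reduced n (alphabet n) (gen_fun (bounded_pairs n)) w =
      sum_reduced n (Letter ` {0..int n - 1}) (macdonald_term q_fls) w"
    by (rule functional_equation_unique[OF fls_X_inv_power_neq_1
          sum_reduced_gen_fun_functional_equation[OF assms(1)]
          sum_reduced_macdonald_functional_equation[OF assms(1) fls_X_inv_power_neq_1]])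
      (simp_all add: sum_reduced_len_0 gen_fun_Nil macdonald_term_def)
  also have "\<dots> = (\<Sum>a \<in> Reduced_C n w. macdonald_term q_fls a)"
    by (simp add: sum_reduced_def Reduced_C_eq)
  finally show ?thesis
    using subst_S_C[OF assms(1), of w] by (simp add: macdonald_term_def)
qed

end
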